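(* Let $\mathcal{C}=(\mathcal{H},\mathcal{K},L,m,n,c,\lambda,\rho,\hat{\alpha},\hat{\beta})$ be an LQCI instance over a finite alphabet $\Sigma$, with label set $\Omega$ and label classes $I_1,\dots,I_{|\Omega|}$. Then $\mathcal{C}$ is feasible (i.e. admits an improvising distribution) if and only if all of the following hold: (1) $\frac{1}{\rho}\le |\Omega| \le \frac{1}{\lambda}$; (2) for every $i\in\{1,\dots,|\Omega|\}$, $\frac{1}{\hat{\beta}_i}\le |I_i|\le \frac{1}{\hat{\alpha}_i}$; (3) the greedy LQCI construction produces a distribution $D$ with $E[\mathcal{K}(w)\mid w\leftarrow D]\le c$.
   Context: Fix a finite alphabet $\Sigma$. An LQCI (labelled quantitative control improvisation) instance is a tuple $\mathcal{C}=(\mathcal{H},\mathcal{K},L,m,n,c,\lambda,\rho,\hat{\alpha},\hat{\beta})$ where $m\le n$ are natural numbers; $\mathcal{H}$ is a hard specification (a set of words over $\Sigma$); $\mathcal{K}:\Sigma^*\to\mathbb{Q}$ is a cost function; $L:\Sigma^*\to\Omega$ is a label function into a finite set $\Omega=\{\ell_1,\dots,\ell_{|\Omega|}\}$; $c\in\mathbb{Q}^+$; $\lambda,\rho\in\mathbb{Q}$ with $0\le\lambda\le\rho\le1$; and for each $i$, $\hat{\alpha}_i,\hat{\beta}_i\in\mathbb{Q}$ with $0\le\hat{\alpha}_i\le\hat{\beta}_i\le1$. Let $\Sigma^{m:n}=\{w\in\Sigma^*: m\le|w|\le n\}$, let $I=\{w\in\Sigma^{m:n}: w \text{ satisfies }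 \mathcal{H}\}$ (the improvisations), let $\Theta=\mathcal{K}(I)=\{\theta_1,\dots,\theta_{|\Theta|}\}$, let $I_{i,k}=\{w\in I: L(w)=\ell_i,\ \mathcal{K}(w)=\theta_k\}$ (cost classes) and $I_i=\bigcup_k I_{i,k}$ (label classes). A distribution $D$ over $\Sigma^*$ is improvising if: (a) $\Pr[w\in I\mid w\leftarrow D]=1$; (b) $E[\mathcal{K}(w)\mid w\leftarrow D]\le c$; (c) for all $i$, $\lambda\le\Pr[w\in I_i\mid w\leftarrow D]\le\rho$; (d) for all $i$ and all $y\in I_i$, $\hat{\alpha}_i\le \Pr[w=y\mid w\in I_i, w\leftarrow D]\le\hat{\beta}_i$. The instance is feasible if an improvising distribution exists. The greedy LQCI construction (defined when conditions (1) and (2) hold) is as follows. Greedy cost construction, for each label $i$: if $\hat{\alpha}_i=\hat{\beta}_i$, give each word of $I_i$ probability $\hat{\alpha}_i$. Otherwise list the cost classes $I_{i,1},\dots,I_{i,|\Theta|}$ in increasing order of cost as $\delta^i_1,\dots,\delta^i_{|\Theta|}$, set $o_i=\frac{1-\hat{\alpha}_i|I_i|}{\hat{\beta}_i-\hat{\alpha}_i}$, and let $r$ be the least index with $\sum_{k=1}^r|\delta^i_k|>o_i$ (or $r=|\Theta|+1$ if none exists). Each word in $\delta^i_j$ with $j<r$ gets probability $\hat{\beta}_i$; the class $\delta^i_r$ gets total probability $\hat{\beta}_i(o_i-\sum_{k=1}^{r-1}|\delta^i_k|)+\hat{\alpha}_i(\sum_{k=1}^{r}|\delta^i_k|-o_i)$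 spread uniformly over its words; each word in $\delta^i_j$ with $j>r$ gets $\hat{\alpha}_i$. Call the resulting distribution on $I_i$ $D_i$. Greedy label construction: list the labels in increasing order of the expected cost of $D_i$; let $u=\lfloor\frac{1-|\Omega|\lambda}{\rho-\lambda}\rfloor$ (if $\lambda=\rho$, every label instead gets probability $\lambda$); the first $u$ labels get probability $\rho$, the next label (if any) gets $1-\rho u-\lambda(|\Omega|-u-1)$, and all remaining labels get $\lambda$; call this distribution over labels $\hat{D}$. The final distribution $D$ samples a label $i$ from $\hat{D}$ and then a word from $D_i$.
   Formalization: Condition (d) is undefined for a label class of probability 0 (possible only if λ = 0); there it is read as: some probability distribution on I_i gives each of its words a probability between α̂_i and β̂_i. Also, 1/0 is read as ∞. *)

theory Defs
  imports "HOL-Probability.Probability"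
begin

text \<open>
  Words over the alphabet are the elements of \<open>lists (alphabet C)\<close>. The labels
  themselves serve as the indices \<open>i\<close>, so \<open>alpha_hat\<close> and \<open>beta_hat\<close> take a label.
\<close>

record ('a, 'l) lqci =
  alphabet :: "'a set"
  hard_spec :: "'a list set"
  cost :: "'a list \<Rightarrow> rat"
  label :: "'a list \<Rightarrow> 'l"
  labels :: "'l set"
  min_len :: nat
  max_len :: nat
  cost_bound :: rat
  lambda :: rat
  rho :: rat
  alpha_hat :: "'l \<Rightarrow> rat"
  beta_hat :: "'l \<Rightarrow> rat"

definition lqci_instance :: "('a, 'l) lqci \<Rightarrow> bool" where
  "lqci_instance C \<longleftrightarrow>
     finite (alphabet C) \<and> finite (labels C) \<and>
     hard_spec C \<subseteq> lists (alphabet C) \<and>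
     (\<forall>w \<in> lists (alphabet C). label C w \<in> labels C) \<and>
     min_len C \<le> max_len C \<and>
     0 < cost_bound C \<and>
     0 \<le> lambda C \<and> lambda C \<le> rho C \<and> rho C \<le> 1 \<and>
     (\<forall>i \<in> labels C. 0 \<le> alpha_hat C i \<and> alpha_hat C i \<le> beta_hat C i \<and> beta_hat C i \<le> 1)"

definition improvisations :: "('a, 'l) lqci \<Rightarrow> 'a list set" where
  "improvisations C =
     {w \<in> lists (alphabet C). min_len C \<le> length w \<and> length w \<le> max_len C \<and> w \<in> hard_spec C}"

definition costs :: "('a, 'l) lqci \<Rightarrow> rat set" where
  "costs C = cost C ` improvisations C"

definition cost_class :: "('a, 'l) lqci \<Rightarrow> 'l \<Rightarrow> rat \<Rightarrow> 'a list set" where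
  "cost_class C i t = {w \<in> improvisations C. label C w = i \<and> cost C w = t}"

definition label_class :: "('a, 'l) lqci \<Rightarrow> 'l \<Rightarrow> 'a list set" where
  "label_class C i = (\<Union>t \<in> costs C. cost_class C i t)"

definition expected_cost :: "('a, 'l) lqci \<Rightarrow> 'a list pmf \<Rightarrow> real" where
  "expected_cost C D = measure_pmf.expectation D (\<lambda>w. real_of_rat (cost C w))"


subsection \<open>Improvising distributions\<close>

text \<open>
  \<open>Q\<close> is a version of the conditional distribution of \<open>D\<close> given \<open>A\<close>. If \<open>A\<close> has positive
  probability then \<open>Q\<close> is the usual conditional distribution. If \<open>A\<close> is a null event the
  elementary conditional probability is undefined, and, as for regular conditional
  distributions, any probability distribution concentrated on \<open>A\<close> is admitted. This case
  arises for label classes only when \<open>lambda C = 0\<close>.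
\<close>

definition cond_dist :: "'b pmf \<Rightarrow> 'b set \<Rightarrow> 'b pmf \<Rightarrow> bool" where
  "cond_dist D A Q \<longleftrightarrow>
     set_pmf Q \<subseteq> A \<and> (measure_pmf.prob D A > 0 \<longrightarrow> Q = cond_pmf D A)"

definition improvising :: "('a, 'l) lqci \<Rightarrow> 'a list pmf \<Rightarrow> bool" where
  "improvising C D \<longleftrightarrow>
     set_pmf D \<subseteq> lists (alphabet C) \<and>
     measure_pmf.prob D (improvisations C) = 1 \<and>
     expected_cost C D \<le> real_of_rat (cost_bound C) \<and>
     (\<forall>i \<in> labels C. real_of_rat (lambda C) \<le> measure_pmf.prob D (label_class C i) \<and>
        measure_pmf.prob D (label_class C i) \<le> real_of_rat (rho C)) \<and>
     (\<forall>i \<in> labels C. \<exists>Q. cond_dist D (label_class C i) Q \<and>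
        (\<forall>y \<in> label_class C i. real_of_rat (alpha_hat C i) \<le> pmf Q y \<and>
           pmf Q y \<le> real_of_rat (beta_hat C i)))"

definition feasible :: "('a, 'l) lqci \<Rightarrow> bool" where
  "feasible C \<longleftrightarrow> (\<exists>D. improvising C D)"


subsection \<open>The greedy construction\<close>

text \<open>
  Positions in the lists of cost classes and of labels are counted from 1. The
  distributions are obtained from explicit weights by \<open>embed_pmf\<close>, which is meaningful
  only if the weights are nonnegative and sum to 1; this is the case when the size
  conditions on the label set and on the label classes hold.
\<close>

definition delta :: "('a, 'l) lqci \<Rightarrow> 'l \<Rightarrow> nat \<Rightarrow> 'a list set" where
  "delta C i k = cost_class C i (sorted_list_of_set (costs C) ! (k - 1))"

definition delta_sum :: "('a, 'l) lqci \<Rightarrow> 'l \<Rightarrow> nat \<Rightarrow> rat" where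
  "delta_sum C i r = (\<Sum>k = 1..r. of_nat (card (delta C i k)))"

definition greedy_o :: "('a, 'l) lqci \<Rightarrow> 'l \<Rightarrow> rat" where
  "greedy_o C i =
     (1 - alpha_hat C i * of_nat (card (label_class C i))) / (beta_hat C i - alpha_hat C i)"

definition greedy_r :: "('a, 'l) lqci \<Rightarrow> 'l \<Rightarrow> nat" where
  "greedy_r C i =
     (LEAST r. 1 \<le> r \<and> (delta_sum C i r > greedy_o C i \<or> r = card (costs C) + 1))"

definition word_weight :: "('a, 'l) lqci \<Rightarrow> 'l \<Rightarrow> 'a list \<Rightarrow> rat" where
  "word_weight C i w =
     (if w \<notin> label_class C i then 0
      else if alpha_hat C i = beta_hat C i then alpha_hat C i
      else
        let r = greedy_r C i;
            j = (THE j. 1 \<le> j \<and> j \<le> card (costs C) \<and> w \<in> delta C i j)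
        in if j < r then beta_hat C i
           else if j = r then
             (beta_hat C i * (greedy_o C i - delta_sum C i (r - 1)) +
              alpha_hat C i * (delta_sum C i r - greedy_o C i)) / of_nat (card (delta C i r))
           else alpha_hat C i)"

definition greedy_word_dist :: "('a, 'l) lqci \<Rightarrow> 'l \<Rightarrow> 'a list pmf" where
  "greedy_word_dist C i = embed_pmf (\<lambda>w. real_of_rat (word_weight C i w))"

text \<open>Ties between labels of equal expected cost are broken arbitrarily.\<close>

definition label_order :: "('a, 'l) lqci \<Rightarrow> 'l list" where
  "label_order C =
     (SOME ls. distinct ls \<and> set ls = labels C \<and>
        sorted (map (\<lambda>i. expected_cost C (greedy_word_dist C i)) ls))"

definition greedy_u :: "('a, 'l) lqci \<Rightarrow> int" where
  "greedy_u C = \<lfloor>(1 - of_nat (card (labels C)) * lambda C) / (rho C - lambda C)\<rfloor>"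

definition label_weight :: "('a, 'l) lqci \<Rightarrow> 'l \<Rightarrow> rat" where
  "label_weight C i =
     (if i \<notin> labels C then 0
      else if lambda C = rho C then lambda C
      else
        let u = greedy_u C;
            p = (THE p. 1 \<le> p \<and> p \<le> card (labels C) \<and> label_order C ! (p - 1) = i)
        in if int p \<le> u then rho C
           else if int p = u + 1 then
             1 - rho C * of_int u - lambda C * (of_nat (card (labels C)) - of_int u - 1)
           else lambda C)"

definition greedy_label_dist :: "('a, 'l) lqci \<Rightarrow> 'l pmf" where
  "greedy_label_dist C = embed_pmf (\<lambda>i. real_of_rat (label_weight C i))"

definition greedy_dist :: "('a, 'l) lqci \<Rightarrow> 'a list pmf" where
  "greedy_dist C = bind_pmf (greedy_label_dist C) (greedy_word_dist C)"


text \<open>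
  Size bounds \<open>1 / x \<le> k \<le> 1 / y\<close> are to be read in the extended reals: the upper bound is
  void for \<open>y = 0\<close>, and the lower bound fails for \<open>x = 0\<close>.
\<close>

lemma one_div_ereal_zero: "1 / (0::ereal) = \<infinity>"
  by (simp add: divide_ereal_def)

end

theory Submission
  imports Defs
begin

text \<open>
  Both stages of the greedy construction are instances of one fractional filling: a budget is
  poured into consecutive blocks of sizes \<open>d 1, d 2, \<dots>\<close>, giving weight \<open>\<beta>\<close> before a pivot block
  and \<open>\<alpha>\<close> after it. For the labels all blocks have size 1. Its optimality is an exchange
  argument: if \<open>t\<close> is the cost at the pivot, then every summand of
  \<open>\<Sum> (p x - w x) * (f x - t)\<close> is nonnegative for every competitor \<open>p\<close> of the greedy weights \<open>w\<close>,
  and the terms with \<open>t\<close> cancel because both weights have the same total. An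
  improvising distribution is a mixture of its conditionals on the label classes, so replacing
  first each conditional and then the label probabilities by the greedy ones can only lower the
  cost; the order matters, since the labels are sorted by the costs of the greedy conditionals.
\<close>

subsection \<open>Greedy filling\<close>

text \<open>The value is the weight of one element of block \<open>j\<close>, not of the whole
  block. The budget \<open>b\<close> counts the elements, fractionally, that are raised from
  \<alpha> to \<beta>.\<close>

definition greedy_fill :: "'b::linordered_field \<Rightarrow> 'b \<Rightarrow> 'b \<Rightarrow> (nat \<Rightarrow> nat) \<Rightarrow> nat \<Rightarrow> nat \<Rightarrow> 'b" where
  "greedy_fill \<alpha> \<beta> b d r j =
     (if j < r then \<beta>
      else if j = r then
        (\<beta> * (b - (\<Sum>k = 1..r - 1. of_nat (d k))) + \<alpha> * ((\<Sum>k = 1..r. of_nat (d k)) - b)) / of_nat (d r)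
      else \<alpha>)"

text \<open>A common specification of the pivots that the construction obtains by
  \<open>LEAST\<close> for words and by a floor for labels. The value \<open>r = n + 1\<close>
  stands for a budget that fills all blocks exactly.\<close>

definition greedy_pivot :: "'b::linordered_field \<Rightarrow> (nat \<Rightarrow> nat) \<Rightarrow> nat \<Rightarrow> nat \<Rightarrow> bool" where
  "greedy_pivot b d n r \<longleftrightarrow>
     1 \<le> r \<and> r \<le> n + 1 \<and> (\<Sum>k = 1..r - 1. of_nat (d k)) \<le> b \<and>
     (if r \<le> n then b < (\<Sum>k = 1..r. of_nat (d k)) else b = (\<Sum>k = 1..n. of_nat (d k)))"

lemma sum_upto_pivot:
  fixes f :: "nat \<Rightarrow> 'b::comm_monoid_add"
  assumes "1 \<le> r"
  shows "(\<Sum>k = 1..r. f k) = (\<Sum>k = 1..r - 1. f k) + f r"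
  using assms by (cases r) auto

text \<open>The pivot weight is a convex combination of \<beta> and \<alpha>: the filled part
  \<open>x\<close> and the unfilled part \<open>y\<close> add up to the block size.\<close>

lemma greedy_fill_bounds:
  fixes b :: "'b::linordered_field"
  assumes "\<alpha> \<le> \<beta>" "greedy_pivot b d n r" "j \<in> {1..n}"
  shows "\<alpha> \<le> greedy_fill \<alpha> \<beta> b d r j" "greedy_fill \<alpha> \<beta> b d r j \<le> \<beta>"
proof -
  define S where "S = (\<Sum>k = 1..r - 1. of_nat (d k) :: 'b)"
  define x where "x = b - S"
  define y where "y = S + of_nat (d r) - b"
  have S: "(\<Sum>k = 1..r. of_nat (d k)) = S + of_nat (d r)"
    using assms(2) sum_upto_pivot[of r "\<lambda>k. of_nat (d k) :: 'b"] unfolding greedy_pivot_def S_def by simp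
  have "\<alpha> \<le> greedy_fill \<alpha> \<beta> b d r j \<and> greedy_fill \<alpha> \<beta> b d r j \<le> \<beta>"
  proof (cases "j = r")
    case True
    have xy: "0 \<le> x" "0 < y" "of_nat (d r) = x + y"
      using assms(2,3) True S unfolding greedy_pivot_def x_def y_def S_def by auto
    have e: "greedy_fill \<alpha> \<beta> b d r j = (\<beta> * x + \<alpha> * y) / (x + y)"
      using True S xy(3) unfolding greedy_fill_def x_def y_def S_def by simp
    have "\<alpha> * x \<le> \<beta> * x" "\<alpha> * y \<le> \<beta> * y"
      using assms(1) xy by (auto intro: mult_right_mono)
    then show ?thesis
      using xy unfolding e by (simp add: pos_le_divide_eq pos_divide_le_eq distrib_left)
  qed (use assms(1) in \<open>auto simp: greedy_fill_def\<close>)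
  then show "\<alpha> \<le> greedy_fill \<alpha> \<beta> b d r j" "greedy_fill \<alpha> \<beta> b d r j \<le> \<beta>"
    by auto
qed

text \<open>All elements receive \<alpha>, and raising \<open>b\<close> of them to \<beta> adds
  \<open>(\<beta> - \<alpha>) * b\<close>. For the budgets of the construction this total is
  1.\<close>

lemma sum_greedy_fill:
  fixes b :: "'b::linordered_field"
  assumes "greedy_pivot b d n r"
  shows "(\<Sum>j = 1..n. of_nat (d j) * greedy_fill \<alpha> \<beta> b d r j) =
    (\<beta> - \<alpha>) * b + \<alpha> * (\<Sum>j = 1..n. of_nat (d j))"
proof (cases "r \<le> n")
  case False
  then have "(\<Sum>j = 1..n. of_nat (d j) * greedy_fill \<alpha> \<beta> b d r j) = (\<Sum>j = 1..n. of_nat (d j) * \<beta>)"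
    by (intro sum.cong) (auto simp: greedy_fill_def)
  also have "\<dots> = \<beta> * b"
    using assms False by (simp add: greedy_pivot_def sum_distrib_left mult.commute)
  finally show ?thesis
    using assms False by (simp add: greedy_pivot_def left_diff_distrib)
next
  case True
  define S where "S = (\<Sum>k = 1..r - 1. of_nat (d k) :: 'b)"
  define T where "T = (\<Sum>k = r + 1..n. of_nat (d k) :: 'b)"
  have r: "1 \<le> r" using assms by (simp add: greedy_pivot_def)
  have S: "(\<Sum>k = 1..r. of_nat (d k)) = S + of_nat (d r)"
    using r sum_upto_pivot[of r "\<lambda>k. of_nat (d k) :: 'b"] unfolding S_def by simp
  \<comment> \<open>The budget is strictly below the sum that includes the pivot block, so this
    block is nonempty and the division by its size is genuine.\<close>
  have pos: "of_nat (d r) \<noteq> (0::'b)"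
  proof
    assume "of_nat (d r) = (0::'b)"
    then have "(\<Sum>k = 1..r. of_nat (d k)) = S" using S by simp
    then show False using assms True by (auto simp: greedy_pivot_def S_def)
  qed
  have split: "(\<Sum>j = 1..n. f j) = (\<Sum>j = 1..r - 1. f j) + f r + (\<Sum>j = r + 1..n. f j)"
    for f :: "nat \<Rightarrow> 'b"
    using sum_upto_pivot[OF r, of f] True r sum.ub_add_nat[of 1 r f "n - r"] by simp
  have "(\<Sum>j = 1..r - 1. of_nat (d j) * greedy_fill \<alpha> \<beta> b d r j) = S * \<beta>"
    unfolding S_def sum_distrib_right using r by (intro sum.cong) (auto simp: greedy_fill_def)
  moreover have "(\<Sum>j = r + 1..n. of_nat (d j) * greedy_fill \<alpha> \<beta> b d r j) = T * \<alpha>"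
    unfolding T_def sum_distrib_right by (intro sum.cong) (auto simp: greedy_fill_def)
  moreover have "of_nat (d r) * greedy_fill \<alpha> \<beta> b d r r = \<beta> * (b - S) + \<alpha> * (S + of_nat (d r) - b)"
    using pos S unfolding greedy_fill_def S_def by simp
  moreover have "(\<Sum>j = 1..n. of_nat (d j)) = S + of_nat (d r) + T"
    unfolding split S_def T_def ..
  ultimately show ?thesis
    unfolding split[of "\<lambda>j. of_nat (d j) * greedy_fill \<alpha> \<beta> b d r j"]
    by (simp add: algebra_simps)
qed

text \<open>Where \<open>f x = t\<close> the factor \<open>f x - t\<close> vanishes, so
  \<open>w\<close> is constrained there only through the total. This leaves room for the partially
  filled pivot.\<close>

lemma threshold_weights_minimal:
  fixes f p w :: "'c \<Rightarrow> 'b::linordered_field"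
  assumes "\<And>x. x \<in> A \<Longrightarrow> \<alpha> \<le> p x \<and> p x \<le> \<beta>"
    and "\<And>x. x \<in> A \<Longrightarrow> f x < t \<Longrightarrow> w x = \<beta>"
    and "\<And>x. x \<in> A \<Longrightarrow> t < f x \<Longrightarrow> w x = \<alpha>"
    and "sum p A = sum w A"
  shows "(\<Sum>x\<in>A. w x * f x) \<le> (\<Sum>x\<in>A. p x * f x)"
proof -
  have "0 \<le> (\<Sum>x\<in>A. (p x - w x) * (f x - t))"
  proof (intro sum_nonneg)
    fix x assume x: "x \<in> A"
    show "0 \<le> (p x - w x) * (f x - t)"
      using assms(1)[OF x] assms(2)[OF x] assms(3)[OF x]
      by (cases "f x" t rule: linorder_cases) (auto intro: mult_nonneg_nonneg mult_nonpos_nonpos)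
  qed
  also have "\<dots> = (\<Sum>x\<in>A. p x * f x) - (\<Sum>x\<in>A. w x * f x) - (sum p A - sum w A) * t"
    by (simp add: left_diff_distrib right_diff_distrib sum_subtractf sum_distrib_right)
  finally show ?thesis using assms(4) by simp
qed

text \<open>In a sorted list a strictly smaller value has a strictly smaller position, so weights
  that switch at position \<open>r\<close> also switch at the value found there. Ties in
  \<open>xs\<close> are harmless.\<close>

lemma greedy_fill_minimal:
  fixes p :: "'c \<Rightarrow> 'b::linordered_field"
  assumes "sorted xs" "length xs = n" "1 \<le> r" "r \<le> n + 1"
    and "\<And>x. x \<in> A \<Longrightarrow> pos x \<in> {1..n}"
    and "\<And>x. x \<in> A \<Longrightarrow> \<alpha> \<le> p x \<and> p x \<le> \<beta>"
    and "\<And>x. x \<in> A \<Longrightarrow> pos x < r \<Longrightarrow> w x = \<beta>"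
    and "\<And>x. x \<in> A \<Longrightarrow> r < pos x \<Longrightarrow> w x = \<alpha>"
    and "sum p A = sum w A"
  shows "(\<Sum>x\<in>A. w x * xs ! (pos x - 1)) \<le> (\<Sum>x\<in>A. p x * xs ! (pos x - 1))"
\<comment> \<open>For \<open>r = n + 1\<close> there is no value at the pivot; the last one serves
  as threshold, since no value exceeds it.\<close>
proof (rule threshold_weights_minimal[where t = "xs ! (min r n - 1)"])
  fix x assume x: "x \<in> A"
  note px = assms(5)[OF x]
  show "\<alpha> \<le> p x \<and> p x \<le> \<beta>" by (rule assms(6)[OF x])
  show "w x = \<beta>" if "xs ! (pos x - 1) < xs ! (min r n - 1)"
  proof (rule assms(7)[OF x], rule ccontr)
    assume "\<not> pos x < r"
    then have "xs ! (min r n - 1) \<le> xs ! (pos x - 1)"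
      using px assms(2) by (intro sorted_nth_mono[OF assms(1)]) auto
    with that show False by simp
  qed
  show "w x = \<alpha>" if "xs ! (min r n - 1) < xs ! (pos x - 1)"
  proof (rule assms(8)[OF x], rule ccontr)
    assume "\<not> r < pos x"
    then have "xs ! (pos x - 1) \<le> xs ! (min r n - 1)"
      using px assms(2,3) by (intro sorted_nth_mono[OF assms(1)]) auto
    with that show False by simp
  qed
qed (rule assms(9))

section \<open>Positions in a list, counted from 1\<close>

text \<open>The description has the shape of the one in \<open>label_weight\<close>, so the two
  coincide once the length of \<open>label_order\<close> is known.\<close>

definition list_pos :: "'b list \<Rightarrow> 'b \<Rightarrow> nat" where
  "list_pos xs x = (THE p. 1 \<le> p \<and> p \<le> length xs \<and> xs ! (p - 1) = x)"

lemma list_pos_eq: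
  assumes "distinct xs" "1 \<le> p" "p \<le> length xs" "xs ! (p - 1) = x"
  shows "list_pos xs x = p"
  unfolding list_pos_def
proof (rule the_equality)
  fix q assume "1 \<le> q \<and> q \<le> length xs \<and> xs ! (q - 1) = x"
  moreover from this have "q - 1 = p - 1"
    using assms nth_eq_iff_index_eq[OF assms(1), of "q - 1" "p - 1"] by auto
  ultimately show "q = p" using assms(2) by linarith
qed (use assms in auto)

lemma list_pos_mem:
  assumes "distinct xs" "x \<in> set xs"
  shows "list_pos xs x \<in> {1..length xs}" "xs ! (list_pos xs x - 1) = x"
proof -
  obtain k where "k < length xs" "xs ! k = x"
    using assms(2) by (auto simp: in_set_conv_nth)
  moreover from this have "list_pos xs x = k + 1"
    using list_pos_eq[OF assms(1), of "k + 1" x] by simp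
  ultimately show "list_pos xs x \<in> {1..length xs}" "xs ! (list_pos xs x - 1) = x"
    by auto
qed

lemma bij_betw_list_pos:
  assumes "distinct xs"
  shows "bij_betw (list_pos xs) (set xs) {1..length xs}"
  by (rule bij_betwI[where g = "\<lambda>p. xs ! (p - 1)"])
    (use list_pos_mem[OF assms] list_pos_eq[OF assms] in auto)

subsection \<open>Finite distributions and mixtures\<close>

lemma pmf_embed_finite:
  assumes "finite A" "\<And>x. x \<notin> A \<Longrightarrow> f x = 0" "\<And>x. x \<in> A \<Longrightarrow> 0 \<le> f x" "sum f A = 1"
  shows "pmf (embed_pmf f) x = f x"
proof (rule pmf_embed_pmf)
  show "0 \<le> f x" for x using assms(2,3)[of x] by (cases "x \<in> A") auto
  have "(\<integral>\<^sup>+ x. ennreal (f x) \<partial>count_space UNIV) = (\<Sum>x\<in>A. ennreal (f x))"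
    using assms by (intro nn_integral_count_space') auto
  also have "\<dots> = 1" using assms by (simp add: sum_ennreal)
  finally show "(\<integral>\<^sup>+ x. ennreal (f x) \<partial>count_space UNIV) = 1" .
qed

text \<open>The product form also covers \<open>x = 0\<close>: there \<open>1 \<le> 0\<close> fails
  and \<open>0 \<le> 1\<close> holds, in agreement with \<open>1 / 0\<close> being infinite.\<close>

lemma size_bound_ereal:
  assumes "0 \<le> x"
  shows "1 / ereal (real_of_rat x) \<le> ereal (real k) \<longleftrightarrow> 1 \<le> x * of_nat k"
    and "ereal (real k) \<le> 1 / ereal (real_of_rat x) \<longleftrightarrow> x * of_nat k \<le> 1"
proof -
  have 1: "1 \<le> x * of_nat k \<longleftrightarrow> 1 \<le> real_of_rat x * real k"
    by (metis of_rat_1 of_rat_less_eq of_rat_mult of_rat_of_nat_eq)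
  have 2: "x * of_nat k \<le> 1 \<longleftrightarrow> real_of_rat x * real k \<le> 1"
    by (metis of_rat_1 of_rat_less_eq of_rat_mult of_rat_of_nat_eq)
  have "1 / ereal (real_of_rat x) = (if x = 0 then \<infinity> else ereal (1 / real_of_rat x))"
    by (auto simp: one_div_ereal_zero one_ereal_def zero_ereal_def[symmetric])
  moreover have "0 < real_of_rat x" if "x \<noteq> 0" using assms that by simp
  ultimately show "1 / ereal (real_of_rat x) \<le> ereal (real k) \<longleftrightarrow> 1 \<le> x * of_nat k"
    and "ereal (real k) \<le> 1 / ereal (real_of_rat x) \<longleftrightarrow> x * of_nat k \<le> 1"
    unfolding 1 2 by (auto simp: field_simps split: if_splits)
qed

text \<open>The source of necessity for both size conditions: it is applied to the label
  probabilities and to the conditional distribution on each label class.\<close>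

lemma uniform_bounds_sum_1:
  assumes "\<And>x. x \<in> A \<Longrightarrow> real_of_rat a \<le> f x \<and> f x \<le> real_of_rat b" "sum f A = 1"
  shows "a * of_nat (card A) \<le> 1" "1 \<le> b * of_nat (card A)"
proof -
  have "real_of_rat (a * of_nat (card A)) = (\<Sum>x\<in>A. real_of_rat a)"
    by (simp add: of_rat_mult mult.commute)
  also have "\<dots> \<le> sum f A" using assms(1) by (intro sum_mono) auto
  finally show "a * of_nat (card A) \<le> 1" using assms(2) by simp
  have "sum f A \<le> (\<Sum>x\<in>A. real_of_rat b)" using assms(1) by (intro sum_mono) auto
  also have "\<dots> = real_of_rat (b * of_nat (card A))"
    by (simp add: of_rat_mult mult.commute)
  finally show "1 \<le> b * of_nat (card A)" using assms(2) by simp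
qed

text \<open>On a null event both sides are 0, so the free choice of \<open>Q\<close> does no harm
  and mixtures can be formed without excluding null classes.\<close>

lemma pmf_eq_prob_times_cond_dist:
  assumes "cond_dist D A Q" "w \<in> A"
  shows "pmf D w = measure_pmf.prob D A * pmf Q w"
proof (cases "measure_pmf.prob D A > 0")
  case True
  then have "set_pmf D \<inter> A \<noteq> {}" by (simp add: measure_pmf_zero_iff less_le)
  then show ?thesis
    using assms True by (simp add: cond_dist_def pmf_cond)
next
  case False
  then have "measure_pmf.prob D A = 0" by (simp add: zero_less_measure_iff)
  moreover from this have "pmf D w = 0"
    using assms(2) by (auto simp: measure_pmf_zero_iff set_pmf_iff)
  ultimately show ?thesis by simp
qed

lemma label_class_eq: "label_class C i = {w \<in> improvisations C. label C w = i}"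
  by (auto simp: label_class_def cost_class_def costs_def)

section \<open>Finiteness of an instance and decomposition along label classes\<close>

context
  fixes C :: "('a, 'l) lqci"
  assumes inst: "lqci_instance C"
begin

lemma finite_improvisations: "finite (improvisations C)"
proof -
  have "finite {w. set w \<subseteq> alphabet C \<and> length w \<le> max_len C}"
    using inst by (intro finite_lists_length_le) (simp add: lqci_instance_def)
  then show ?thesis
    by (rule rev_finite_subset) (auto simp: improvisations_def)
qed

lemma finite_label_class: "finite (label_class C i)"
  using finite_improvisations by (simp add: label_class_eq)

lemma finite_costs: "finite (costs C)"
  using finite_improvisations by (simp add: costs_def)

lemma finite_labels: "finite (labels C)"
  using inst by (simp add: lqci_instance_def)

lemma label_mem: "w \<in> improvisations C \<Longrightarrow> label C w \<in> labels C"
  using inst by (auto simp: lqci_instance_def improvisations_def)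

lemma sum_improvisations:
  fixes f :: "'a list \<Rightarrow> 'b::comm_monoid_add"
  shows "sum f (improvisations C) = (\<Sum>i\<in>labels C. sum f (label_class C i))"
  unfolding label_class_eq
  using label_mem by (intro sum.group[symmetric] finite_improvisations finite_labels) auto

lemma expected_cost_label_class:
  assumes "set_pmf Q \<subseteq> label_class C i"
  shows "expected_cost C Q = (\<Sum>w\<in>label_class C i. pmf Q w * real_of_rat (cost C w))"
  using assms unfolding expected_cost_def
  by (subst integral_measure_pmf[OF finite_label_class[of i]]) auto

text \<open>\<open>P\<close> and \<open>Q\<close> are kept abstract to serve both an improvising
  distribution with its conditionals and the greedy distribution.\<close>

lemma expected_cost_mixture:
  assumes "set_pmf D \<subseteq> improvisations C"
    and "\<And>i. i \<in> labels C \<Longrightarrow> set_pmf (Q i) \<subseteq> label_class C i"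
    and "\<And>i w. i \<in> labels C \<Longrightarrow> w \<in> label_class C i \<Longrightarrow> pmf D w = P i * pmf (Q i) w"
  shows "expected_cost C D = (\<Sum>i\<in>labels C. P i * expected_cost C (Q i))"
proof -
  have "expected_cost C D = (\<Sum>w\<in>improvisations C. pmf D w * real_of_rat (cost C w))"
    using assms(1) unfolding expected_cost_def
    by (subst integral_measure_pmf[OF finite_improvisations]) auto
  also have "\<dots> = (\<Sum>i\<in>labels C. \<Sum>w\<in>label_class C i. pmf D w * real_of_rat (cost C w))"
    by (rule sum_improvisations)
  also have "\<dots> = (\<Sum>i\<in>labels C. P i * expected_cost C (Q i))"
    by (intro sum.cong refl)
      (simp add: expected_cost_label_class[OF assms(2)] assms(3) sum_distrib_left mult.assoc)
  finally show ?thesis .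
qed

lemma costs_list:
  shows "length (sorted_list_of_set (costs C)) = card (costs C)"
    and "set (sorted_list_of_set (costs C)) = costs C"
  using finite_costs by auto

subsection \<open>The greedy word distributions\<close>

lemma cost_pos:
  assumes "w \<in> label_class C i"
  shows "list_pos (sorted_list_of_set (costs C)) (cost C w) \<in> {1..card (costs C)}"
    and "sorted_list_of_set (costs C) ! (list_pos (sorted_list_of_set (costs C)) (cost C w) - 1) = cost C w"
proof -
  have "cost C w \<in> set (sorted_list_of_set (costs C))"
    using assms unfolding costs_list(2) by (auto simp: label_class_eq costs_def)
  from list_pos_mem[OF _ this] show
    "list_pos (sorted_list_of_set (costs C)) (cost C w) \<in> {1..card (costs C)}"
    "sorted_list_of_set (costs C) ! (list_pos (sorted_list_of_set (costs C)) (cost C w) - 1) = cost C w"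
    by (auto simp: costs_list(1))
qed

text \<open>The cost classes are the fibres of the position of the cost, which makes them disjoint
  blocks in the sense of \<open>greedy_fill\<close>.\<close>

lemma delta_eq:
  assumes "j \<in> {1..card (costs C)}"
  shows "delta C i j =
    {w \<in> label_class C i. list_pos (sorted_list_of_set (costs C)) (cost C w) = j}"
proof (intro set_eqI iffI)
  fix w assume "w \<in> delta C i j"
  then have w: "w \<in> label_class C i" "sorted_list_of_set (costs C) ! (j - 1) = cost C w"
    by (auto simp: delta_def cost_class_def label_class_eq)
  then have "list_pos (sorted_list_of_set (costs C)) (cost C w) = j"
    using assms costs_list(1) by (intro list_pos_eq) auto
  with w(1) show "w \<in> {w \<in> label_class C i. list_pos (sorted_list_of_set (costs C)) (cost C w) = j}"
    by simp
next
  fix w assume w: "w \<in> {w \<in> label_class C i. list_pos (sorted_list_of_set (costs C)) (cost C w) = j}"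
  then have "sorted_list_of_set (costs C) ! (j - 1) = cost C w"
    using cost_pos(2) by blast
  then show "w \<in> delta C i j"
    using w by (simp add: delta_def cost_class_def label_class_eq)
qed

text \<open>Grouping words by the position of their cost turns sums over words into the block sums
  of \<open>sum_greedy_fill\<close>.\<close>

lemma sum_label_class_pos:
  fixes g :: "nat \<Rightarrow> 'b::semiring_1"
  shows "(\<Sum>w\<in>label_class C i. g (list_pos (sorted_list_of_set (costs C)) (cost C w))) =
    (\<Sum>j = 1..card (costs C). of_nat (card (delta C i j)) * g j)"
proof -
  let ?pos = "\<lambda>w. list_pos (sorted_list_of_set (costs C)) (cost C w)"
  have "(\<Sum>w\<in>label_class C i. g (?pos w)) =
    (\<Sum>j = 1..card (costs C). \<Sum>w | w \<in> label_class C i \<and> ?pos w = j. g (?pos w))"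
    using cost_pos(1) by (intro sum.group[symmetric] finite_label_class) auto
  also have "\<dots> = (\<Sum>j = 1..card (costs C). of_nat (card (delta C i j)) * g j)"
    by (intro sum.cong refl) (simp add: delta_eq)
  finally show ?thesis .
qed

lemma delta_sum_all: "delta_sum C i (card (costs C)) = of_nat (card (label_class C i))"
  using sum_label_class_pos[of "\<lambda>_. 1::rat" i] by (simp add: delta_sum_def)

context
  fixes i
  assumes i: "i \<in> labels C"
    and size: "1 \<le> beta_hat C i * of_nat (card (label_class C i))"
      "alpha_hat C i * of_nat (card (label_class C i)) \<le> 1"
begin

lemma hat_bounds:
  shows "0 \<le> alpha_hat C i" "alpha_hat C i \<le> beta_hat C i"
  using inst i by (auto simp: lqci_instance_def)

text \<open>The size condition on the class says exactly that the budget lies between 0 and the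
  class size; leastness of \<open>greedy_r\<close> gives the rest.\<close>

lemma greedy_r_pivot:
  assumes "alpha_hat C i \<noteq> beta_hat C i"
  shows "greedy_pivot (greedy_o C i) (\<lambda>j. card (delta C i j)) (card (costs C)) (greedy_r C i)"
proof -
  let ?n = "card (costs C)"
  let ?P = "\<lambda>r. 1 \<le> r \<and> (delta_sum C i r > greedy_o C i \<or> r = ?n + 1)"
  let ?r = "greedy_r C i"
  have ab: "0 < beta_hat C i - alpha_hat C i" using assms hat_bounds by simp
  have o: "0 \<le> greedy_o C i" "greedy_o C i \<le> of_nat (card (label_class C i))"
    using ab size by (auto simp: greedy_o_def pos_divide_le_eq algebra_simps intro!: divide_nonneg_pos)
  have P: "?P ?r" unfolding greedy_r_def by (rule LeastI[of _ "?n + 1"]) simp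
  have le: "?r \<le> ?n + 1" unfolding greedy_r_def by (rule Least_le) simp
  have prev: "delta_sum C i (?r - 1) \<le> greedy_o C i"
  \<comment> \<open>Leastness says nothing about the predecessor 0, which is not an admissible
    index; there the sum is empty and the budget is nonnegative.\<close>
  proof (cases "?r = 1")
    case True
    then show ?thesis using o(1) by (simp add: delta_sum_def)
  next
    case False
    then have "\<not> ?P (?r - 1)"
      using P not_less_Least[of "?r - 1" ?P] unfolding greedy_r_def[symmetric] by simp
    then show ?thesis using False P by auto
  qed
  show ?thesis
  proof (cases "?r = ?n + 1")
    case True
    \<comment> \<open>With no pivot among the classes, the budget is squeezed between the sum of all
      class sizes and the size of the label class, which are equal.\<close>
    then have "greedy_o C i = delta_sum C i ?n"
      using prev o(2) delta_sum_all[of i] by simp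
    then show ?thesis
      using True unfolding greedy_pivot_def delta_sum_def[symmetric] by simp
  next
    case False
    then show ?thesis
      using P le prev unfolding greedy_pivot_def delta_sum_def[symmetric] by simp
  qed
qed

lemma word_weight_fill:
  assumes "alpha_hat C i \<noteq> beta_hat C i" "w \<in> label_class C i"
  shows "word_weight C i w =
    greedy_fill (alpha_hat C i) (beta_hat C i) (greedy_o C i) (\<lambda>j. card (delta C i j)) (greedy_r C i)
      (list_pos (sorted_list_of_set (costs C)) (cost C w))"
proof -
  have "(THE j. 1 \<le> j \<and> j \<le> card (costs C) \<and> w \<in> delta C i j) =
    list_pos (sorted_list_of_set (costs C)) (cost C w)"
    using cost_pos(1)[OF assms(2)] assms(2) by (intro the_equality) (auto simp: delta_eq)
  then show ?thesis
    using assms by (simp add: word_weight_def greedy_fill_def Let_def delta_sum_def)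
qed

lemma word_weight_bounds:
  assumes "w \<in> label_class C i"
  shows "alpha_hat C i \<le> word_weight C i w" "word_weight C i w \<le> beta_hat C i"
proof -
  have "alpha_hat C i \<le> word_weight C i w \<and> word_weight C i w \<le> beta_hat C i"
  proof (cases "alpha_hat C i = beta_hat C i")
    case True
    then show ?thesis using assms by (simp add: word_weight_def)
  next
    case False
    show ?thesis
      unfolding word_weight_fill[OF False assms]
      using greedy_fill_bounds[OF hat_bounds(2) greedy_r_pivot[OF False] cost_pos(1)[OF assms]] by simp
  qed
  then show "alpha_hat C i \<le> word_weight C i w" "word_weight C i w \<le> beta_hat C i" by auto
qed

text \<open>If the two bounds coincide, the size conditions force their product with the class size
  to be 1. Otherwise \<open>greedy_o\<close> is chosen to make the total 1.\<close>

lemma sum_word_weight: "(\<Sum>w\<in>label_class C i. word_weight C i w) = 1"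
proof (cases "alpha_hat C i = beta_hat C i")
  case True
  then have "(\<Sum>w\<in>label_class C i. word_weight C i w) = (\<Sum>w\<in>label_class C i. alpha_hat C i)"
    by (intro sum.cong) (simp_all add: word_weight_def)
  then show ?thesis using size True by (simp add: mult.commute)
next
  case False
  have "(\<Sum>w\<in>label_class C i. word_weight C i w) =
    (beta_hat C i - alpha_hat C i) * greedy_o C i
      + alpha_hat C i * (\<Sum>j = 1..card (costs C). of_nat (card (delta C i j)))"
    unfolding sum_greedy_fill[OF greedy_r_pivot[OF False], symmetric] sum_label_class_pos[symmetric]
    by (intro sum.cong refl word_weight_fill[OF False])
  then show ?thesis
    using False unfolding delta_sum_def[symmetric] delta_sum_all by (simp add: greedy_o_def)
qed

lemma pmf_greedy_word_dist: "pmf (greedy_word_dist C i) w = real_of_rat (word_weight C i w)"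
  unfolding greedy_word_dist_def
proof (rule pmf_embed_finite[OF finite_label_class[of i]])
  show "real_of_rat (word_weight C i w) = 0" if "w \<notin> label_class C i" for w
    using that by (simp add: word_weight_def)
  show "0 \<le> real_of_rat (word_weight C i w)" if "w \<in> label_class C i" for w
    using word_weight_bounds(1)[OF that] hat_bounds(1) by simp
  show "(\<Sum>w\<in>label_class C i. real_of_rat (word_weight C i w)) = 1"
    using sum_word_weight by (simp add: of_rat_sum[symmetric])
qed

lemma set_greedy_word_dist: "set_pmf (greedy_word_dist C i) \<subseteq> label_class C i"
proof
  fix w assume "w \<in> set_pmf (greedy_word_dist C i)"
  then have "word_weight C i w \<noteq> 0" by (simp add: set_pmf_iff pmf_greedy_word_dist)
  then show "w \<in> label_class C i" by (auto simp: word_weight_def split: if_splits)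
qed

text \<open>With equal bounds \<open>Q\<close> has no freedom; otherwise
  \<open>greedy_fill_minimal\<close> applies, as both weights sum to 1.\<close>

lemma greedy_word_dist_minimal:
  assumes Q: "set_pmf Q \<subseteq> label_class C i"
    and bounds: "\<And>w. w \<in> label_class C i \<Longrightarrow>
      real_of_rat (alpha_hat C i) \<le> pmf Q w \<and> pmf Q w \<le> real_of_rat (beta_hat C i)"
  shows "expected_cost C (greedy_word_dist C i) \<le> expected_cost C Q"
proof (cases "alpha_hat C i = beta_hat C i")
  case True
  have "pmf Q w = real_of_rat (word_weight C i w)" if "w \<in> label_class C i" for w
    using bounds[OF that] that True by (simp add: word_weight_def)
  then show ?thesis
    unfolding expected_cost_label_class[OF Q]
      expected_cost_label_class[OF set_greedy_word_dist] pmf_greedy_word_dist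
    by simp
next
  case False
  let ?ts = "sorted_list_of_set (costs C)"
  let ?pos = "\<lambda>w. list_pos ?ts (cost C w)"
  let ?w = "\<lambda>w. real_of_rat (word_weight C i w)"
  \<comment> \<open>The competitor has real weights, so the rational cost list is moved to the
    reals; the embedding is monotone and keeps it sorted.\<close>
  have cost: "map real_of_rat ?ts ! (?pos w - 1) = real_of_rat (cost C w)"
    if "w \<in> label_class C i" for w
    using cost_pos[OF that] costs_list(1) by (subst nth_map) auto
  have "(\<Sum>w\<in>label_class C i. ?w w * map real_of_rat ?ts ! (?pos w - 1))
    \<le> (\<Sum>w\<in>label_class C i. pmf Q w * map real_of_rat ?ts ! (?pos w - 1))"
  proof (rule greedy_fill_minimal[where r = "greedy_r C i" and n = "card (costs C)"])
    show "sorted (map real_of_rat ?ts)"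
      by (rule sorted_map_mono) (auto simp: mono_on_def of_rat_less_eq)
    show "1 \<le> greedy_r C i" "greedy_r C i \<le> card (costs C) + 1"
      using greedy_r_pivot[OF False] by (auto simp: greedy_pivot_def)
    show "?pos w \<in> {1..card (costs C)}" if "w \<in> label_class C i" for w
      by (rule cost_pos(1)[OF that])
    show "?w w = real_of_rat (beta_hat C i)" if "w \<in> label_class C i" "?pos w < greedy_r C i" for w
      using that by (simp add: word_weight_fill[OF False] greedy_fill_def)
    show "?w w = real_of_rat (alpha_hat C i)" if "w \<in> label_class C i" "greedy_r C i < ?pos w" for w
      using that by (simp add: word_weight_fill[OF False] greedy_fill_def)
    have "sum (pmf Q) (label_class C i) = 1"
      using Q by (intro sum_pmf_eq_1 finite_label_class)
    then show "sum (pmf Q) (label_class C i) = sum ?w (label_class C i)"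
      using sum_word_weight by (simp add: of_rat_sum[symmetric])
  qed (use bounds costs_list(1) in auto)
  then show ?thesis
    unfolding expected_cost_label_class[OF Q]
      expected_cost_label_class[OF set_greedy_word_dist] pmf_greedy_word_dist
    by (simp add: cost del: One_nat_def cong: sum.cong)
qed

end

subsection \<open>The greedy label distribution\<close>

context
  assumes size: "1 \<le> rho C * of_nat (card (labels C))" "lambda C * of_nat (card (labels C)) \<le> 1"
begin

lemma lambda_rho: "0 \<le> lambda C" "lambda C \<le> rho C"
  using inst by (auto simp: lqci_instance_def)

text \<open>Sorting any enumeration shows that the choice is possible. Nothing else about the chosen
  list is used, so ties may fall either way.\<close>

lemma label_order:
  shows "distinct (label_order C)" "set (label_order C) = labels C"
    and "sorted (map (\<lambda>i. expected_cost C (greedy_word_dist C i)) (label_order C))"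
proof -
  obtain ls where "distinct ls" "set ls = labels C"
    using finite_distinct_list[OF finite_labels] by blast
  then have "\<exists>ls. distinct ls \<and> set ls = labels C \<and>
      sorted (map (\<lambda>i. expected_cost C (greedy_word_dist C i)) ls)"
    by (intro exI[of _ "sort_key (\<lambda>i. expected_cost C (greedy_word_dist C i)) ls"]) auto
  from someI_ex[OF this] show "distinct (label_order C)" "set (label_order C) = labels C"
    "sorted (map (\<lambda>i. expected_cost C (greedy_word_dist C i)) (label_order C))"
    unfolding label_order_def by auto
qed

lemma length_label_order: "length (label_order C) = card (labels C)"
  using label_order(1,2) distinct_card by metis

text \<open>The counterpart of \<open>greedy_o\<close> for labels; \<open>greedy_u\<close> is its
  floor.\<close>

abbreviation label_budget :: rat where
  "label_budget \<equiv> (1 - of_nat (card (labels C)) * lambda C) / (rho C - lambda C)"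

text \<open>With unit blocks the first \<open>r\<close> sizes sum to \<open>r\<close>, so the pivot
  is the floor of the budget plus 1.\<close>

lemma greedy_u_pivot:
  assumes "lambda C \<noteq> rho C"
  shows "0 \<le> greedy_u C"
    and "greedy_pivot label_budget (\<lambda>_. 1) (card (labels C)) (nat (greedy_u C) + 1)"
proof -
  have lr: "0 < rho C - lambda C" using assms lambda_rho by simp
  have b: "0 \<le> label_budget" "label_budget \<le> of_nat (card (labels C))"
    using lr size by (auto simp: pos_divide_le_eq algebra_simps intro!: divide_nonneg_pos)
  have u: "of_int (greedy_u C) \<le> label_budget" "label_budget < of_int (greedy_u C) + 1"
    using floor_correct[of label_budget] unfolding greedy_u_def by auto
  show u0: "0 \<le> greedy_u C" using b(1) by (simp add: greedy_u_def)
  have nu: "(of_nat (nat (greedy_u C)) :: rat) = of_int (greedy_u C)"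
    using u0 by simp
  have "(of_nat (nat (greedy_u C)) :: rat) \<le> of_nat (card (labels C))"
    unfolding nu using u(1) b(2) by (rule order_trans)
  then have un: "nat (greedy_u C) \<le> card (labels C)" by (simp only: of_nat_le_iff)
  show "greedy_pivot label_budget (\<lambda>_. 1) (card (labels C)) (nat (greedy_u C) + 1)"
  proof (cases "nat (greedy_u C) + 1 \<le> card (labels C)")
    case True
    then show ?thesis using u nu unfolding greedy_pivot_def by simp
  next
    case False
    \<comment> \<open>Here every label is filled: the budget lies between its floor and the number
      of labels, which now agree.\<close>
    then have "card (labels C) = nat (greedy_u C)" using un by simp
    then have "label_budget = of_nat (card (labels C))" using u(1) b(2) nu by simp
    then show ?thesis using un False unfolding greedy_pivot_def by simp
  qed
qed

lemma label_weight_fill: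
  assumes "lambda C \<noteq> rho C" "i \<in> labels C"
  shows "label_weight C i =
    greedy_fill (lambda C) (rho C) label_budget (\<lambda>_. 1) (nat (greedy_u C) + 1) (list_pos (label_order C) i)"
proof -
  let ?b = label_budget
  let ?u = "of_int (greedy_u C) :: rat"
  let ?p = "list_pos (label_order C) i"
  have "(THE p. 1 \<le> p \<and> p \<le> card (labels C) \<and> label_order C ! (p - 1) = i) = ?p"
    by (simp add: list_pos_def length_label_order)
  then have e: "label_weight C i = (if int ?p \<le> greedy_u C then rho C
    else if int ?p = greedy_u C + 1
      then 1 - rho C * ?u - lambda C * (of_nat (card (labels C)) - ?u - 1) else lambda C)"
    using assms by (simp add: label_weight_def Let_def)
  \<comment> \<open>Clearing the denominator of the budget turns the generic pivot weight into the
    remainder formula of the construction.\<close>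
  have "(rho C - lambda C) * ?b = 1 - of_nat (card (labels C)) * lambda C"
    using assms(1) by simp
  then have f: "rho C * (?b - ?u) + lambda C * (?u + 1 - ?b) =
      1 - rho C * ?u - lambda C * (of_nat (card (labels C)) - ?u - 1)"
    by (simp only: algebra_simps)
  have u0: "0 \<le> greedy_u C" by (rule greedy_u_pivot(1)[OF assms(1)])
  then have nu: "(of_nat (nat (greedy_u C)) :: rat) = ?u" by simp
  show ?thesis
    unfolding e greedy_fill_def using u0
    by (auto simp: nu f[symmetric] add.commute)
qed

lemma label_weight_bounds:
  assumes "i \<in> labels C"
  shows "lambda C \<le> label_weight C i" "label_weight C i \<le> rho C"
proof -
  have "lambda C \<le> label_weight C i \<and> label_weight C i \<le> rho C"
  proof (cases "lambda C = rho C")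
    case True
    then show ?thesis using assms by (simp add: label_weight_def)
  next
    case False
    have "list_pos (label_order C) i \<in> {1..card (labels C)}"
      using list_pos_mem(1)[OF label_order(1)] assms label_order(2) length_label_order by simp
    then show ?thesis
      unfolding label_weight_fill[OF False assms]
      using greedy_fill_bounds[OF lambda_rho(2) greedy_u_pivot(2)[OF False]] by simp
  qed
  then show "lambda C \<le> label_weight C i" "label_weight C i \<le> rho C" by auto
qed

lemma sum_label_weight: "(\<Sum>i\<in>labels C. label_weight C i) = 1"
proof (cases "lambda C = rho C")
  case True
  then have "(\<Sum>i\<in>labels C. label_weight C i) = (\<Sum>i\<in>labels C. lambda C)"
    by (intro sum.cong) (simp_all add: label_weight_def)
  then show ?thesis using size True by (simp add: mult.commute)
next
  case False
  let ?g = "greedy_fill (lambda C) (rho C) label_budget (\<lambda>_. 1) (nat (greedy_u C) + 1)"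
  have "(\<Sum>i\<in>labels C. label_weight C i) = (\<Sum>i\<in>labels C. ?g (list_pos (label_order C) i))"
    by (intro sum.cong refl label_weight_fill[OF False])
  also have "\<dots> = (\<Sum>p = 1..card (labels C). ?g p)"
    using bij_betw_list_pos[OF label_order(1)] unfolding label_order(2) length_label_order
    by (rule sum.reindex_bij_betw)
  also have "\<dots> = (rho C - lambda C) * label_budget + lambda C * of_nat (card (labels C))"
    using sum_greedy_fill[OF greedy_u_pivot(2)[OF False], of "lambda C" "rho C"] by simp
  also have "\<dots> = 1" using False by simp
  finally show ?thesis .
qed

lemma pmf_greedy_label_dist: "pmf (greedy_label_dist C) i = real_of_rat (label_weight C i)"
  unfolding greedy_label_dist_def
proof (rule pmf_embed_finite[OF finite_labels])
  show "real_of_rat (label_weight C i) = 0" if "i \<notin> labels C" for i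
    using that by (simp add: label_weight_def)
  show "0 \<le> real_of_rat (label_weight C i)" if "i \<in> labels C" for i
    using label_weight_bounds(1)[OF that] lambda_rho(1) by simp
  show "(\<Sum>i\<in>labels C. real_of_rat (label_weight C i)) = 1"
    using sum_label_weight by (simp add: of_rat_sum[symmetric])
qed

lemma set_greedy_label_dist: "set_pmf (greedy_label_dist C) \<subseteq> labels C"
proof
  fix i assume "i \<in> set_pmf (greedy_label_dist C)"
  then have "label_weight C i \<noteq> 0" by (simp add: set_pmf_iff pmf_greedy_label_dist)
  then show "i \<in> labels C" by (auto simp: label_weight_def split: if_splits)
qed

text \<open>Both sides use the costs of the greedy word distributions, the very keys by which
  \<open>label_order\<close> is sorted.\<close>

lemma label_weight_minimal:
  fixes P :: "'l \<Rightarrow> real"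
  assumes "\<And>i. i \<in> labels C \<Longrightarrow> real_of_rat (lambda C) \<le> P i \<and> P i \<le> real_of_rat (rho C)"
    and "sum P (labels C) = 1"
  shows "(\<Sum>i\<in>labels C. real_of_rat (label_weight C i) * expected_cost C (greedy_word_dist C i))
    \<le> (\<Sum>i\<in>labels C. P i * expected_cost C (greedy_word_dist C i))"
proof (cases "lambda C = rho C")
  case True
  have "P i = real_of_rat (label_weight C i)" if "i \<in> labels C" for i
    using assms(1)[OF that] that True by (simp add: label_weight_def)
  then show ?thesis by simp
next
  case False
  let ?E = "\<lambda>i. expected_cost C (greedy_word_dist C i)"
  let ?xs = "map ?E (label_order C)"
  let ?pos = "list_pos (label_order C)"
  have pos: "?pos i \<in> {1..card (labels C)}" "?xs ! (?pos i - 1) = ?E i" if "i \<in> labels C" for i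
    using list_pos_mem[OF label_order(1), of i] that label_order(2) length_label_order by auto
  have "(\<Sum>i\<in>labels C. real_of_rat (label_weight C i) * ?xs ! (?pos i - 1))
    \<le> (\<Sum>i\<in>labels C. P i * ?xs ! (?pos i - 1))"
  proof (rule greedy_fill_minimal[where r = "nat (greedy_u C) + 1" and n = "card (labels C)"])
    show "sorted ?xs" by (rule label_order(3))
    show "1 \<le> nat (greedy_u C) + 1" "nat (greedy_u C) + 1 \<le> card (labels C) + 1"
      using greedy_u_pivot(2)[OF False] by (auto simp: greedy_pivot_def)
    show "real_of_rat (label_weight C i) = real_of_rat (rho C)"
      if "i \<in> labels C" "?pos i < nat (greedy_u C) + 1" for i
      using that by (simp add: label_weight_fill[OF False] greedy_fill_def)
    show "real_of_rat (label_weight C i) = real_of_rat (lambda C)"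
      if "i \<in> labels C" "nat (greedy_u C) + 1 < ?pos i" for i
      using that by (simp add: label_weight_fill[OF False] greedy_fill_def)
    show "sum P (labels C) = (\<Sum>i\<in>labels C. real_of_rat (label_weight C i))"
      using assms(2) sum_label_weight by (simp add: of_rat_sum[symmetric])
  qed (use assms(1) pos(1) length_label_order in auto)
  then show ?thesis by (simp add: pos(2) del: One_nat_def cong: sum.cong)
qed

end

subsection \<open>Feasibility and optimality\<close>

context
  assumes label_size: "1 \<le> rho C * of_nat (card (labels C))" "lambda C * of_nat (card (labels C)) \<le> 1"
    and class_size: "\<And>i. i \<in> labels C \<Longrightarrow> 1 \<le> beta_hat C i * of_nat (card (label_class C i))"
      "\<And>i. i \<in> labels C \<Longrightarrow> alpha_hat C i * of_nat (card (label_class C i)) \<le> 1"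
begin

lemma set_greedy_dist: "set_pmf (greedy_dist C) \<subseteq> improvisations C"
proof
  fix w assume "w \<in> set_pmf (greedy_dist C)"
  then obtain i where "i \<in> labels C" "w \<in> set_pmf (greedy_word_dist C i)"
    using set_greedy_label_dist[OF label_size] by (auto simp: greedy_dist_def)
  then have "w \<in> label_class C i"
    using set_greedy_word_dist[OF _ class_size] by blast
  then show "w \<in> improvisations C" by (simp add: label_class_eq)
qed

text \<open>Label classes are disjoint and each greedy word distribution vanishes off its own class,
  so one summand survives.\<close>

lemma pmf_greedy_dist:
  assumes i: "i \<in> labels C" and w: "w \<in> label_class C i"
  shows "pmf (greedy_dist C) w = real_of_rat (label_weight C i) * pmf (greedy_word_dist C i) w"
proof -
  have "pmf (greedy_dist C) w =
    (\<Sum>j\<in>labels C. real_of_rat (label_weight C j) * pmf (greedy_word_dist C j) w)"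
    unfolding greedy_dist_def pmf_bind
    using set_greedy_label_dist[OF label_size]
    by (subst integral_measure_pmf[OF finite_labels])
      (auto simp: pmf_greedy_label_dist[OF label_size])
  also have "\<dots> = (\<Sum>j\<in>{i}. real_of_rat (label_weight C j) * pmf (greedy_word_dist C j) w)"
  proof (rule sum.mono_neutral_right[OF finite_labels])
    have "pmf (greedy_word_dist C j) w = 0" if "j \<in> labels C - {i}" for j
      using that w pmf_greedy_word_dist[OF _ class_size]
      by (auto simp: word_weight_def label_class_eq)
    then show "\<forall>j\<in>labels C - {i}. real_of_rat (label_weight C j) * pmf (greedy_word_dist C j) w = 0"
      by simp
  qed (use i in simp)
  finally show ?thesis by simp
qed

lemma prob_greedy_dist:
  assumes i: "i \<in> labels C"
  shows "measure_pmf.prob (greedy_dist C) (label_class C i) = real_of_rat (label_weight C i)"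
proof -
  have "measure_pmf.prob (greedy_dist C) (label_class C i) = (\<Sum>w\<in>label_class C i. pmf (greedy_dist C) w)"
    by (rule measure_measure_pmf_finite[OF finite_label_class])
  also have "\<dots> = real_of_rat (label_weight C i) * (\<Sum>w\<in>label_class C i. pmf (greedy_word_dist C i) w)"
    by (simp add: pmf_greedy_dist[OF i] sum_distrib_left)
  also have "(\<Sum>w\<in>label_class C i. pmf (greedy_word_dist C i) w) = 1"
    by (rule sum_pmf_eq_1[OF finite_label_class set_greedy_word_dist[OF i class_size[OF i]]])
  finally show ?thesis by simp
qed

text \<open>For a label of weight 0 only the support matters, so the greedy word distribution is an
  admissible conditional in every case.\<close>

lemma cond_dist_greedy_dist:
  assumes i: "i \<in> labels C"
  shows "cond_dist (greedy_dist C) (label_class C i) (greedy_word_dist C i)"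
proof -
  have sub: "set_pmf (greedy_word_dist C i) \<subseteq> label_class C i"
    by (rule set_greedy_word_dist[OF i class_size[OF i]])
  have "greedy_word_dist C i = cond_pmf (greedy_dist C) (label_class C i)"
    if pos: "measure_pmf.prob (greedy_dist C) (label_class C i) > 0"
  proof (rule pmf_eqI)
    fix w
    from pos have "set_pmf (greedy_dist C) \<inter> label_class C i \<noteq> {}"
      by (simp add: measure_pmf_zero_iff less_le)
    then show "pmf (greedy_word_dist C i) w = pmf (cond_pmf (greedy_dist C) (label_class C i)) w"
      using pos sub i prob_greedy_dist[OF i] pmf_greedy_dist[OF i, of w]
      by (auto simp: pmf_cond set_pmf_iff)
  qed
  then show ?thesis using sub by (simp add: cond_dist_def)
qed

lemma improvising_greedy_dist:
  assumes "expected_cost C (greedy_dist C) \<le> real_of_rat (cost_bound C)"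
  shows "improvising C (greedy_dist C)"
proof -
  have "measure_pmf.prob (greedy_dist C) (improvisations C) = 1"
    using set_greedy_dist by (simp add: measure_pmf.prob_eq_1 AE_measure_pmf_iff subset_iff)
  moreover have "set_pmf (greedy_dist C) \<subseteq> lists (alphabet C)"
    using set_greedy_dist by (auto simp: improvisations_def)
  moreover have "\<exists>Q. cond_dist (greedy_dist C) (label_class C i) Q \<and>
      (\<forall>y\<in>label_class C i. real_of_rat (alpha_hat C i) \<le> pmf Q y \<and> pmf Q y \<le> real_of_rat (beta_hat C i))"
    if i: "i \<in> labels C" for i
    using cond_dist_greedy_dist[OF i] word_weight_bounds[OF i class_size[OF i]]
    by (intro exI[of _ "greedy_word_dist C i"])
      (simp add: pmf_greedy_word_dist[OF i class_size[OF i]] of_rat_less_eq)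
  ultimately show ?thesis
    using assms label_weight_bounds[OF label_size]
    by (simp add: improvising_def prob_greedy_dist of_rat_less_eq)
qed

lemma expected_cost_greedy_dist:
  "expected_cost C (greedy_dist C) =
    (\<Sum>i\<in>labels C. real_of_rat (label_weight C i) * expected_cost C (greedy_word_dist C i))"
  by (rule expected_cost_mixture[OF set_greedy_dist])
    (use set_greedy_word_dist[OF _ class_size] pmf_greedy_dist in blast)+

end

section \<open>Necessity and optimality: an arbitrary improvising distribution\<close>

context
  fixes D
  assumes D: "improvising C D"
begin

lemma set_improvising: "set_pmf D \<subseteq> improvisations C"
  using D by (auto simp: improvising_def measure_pmf.prob_eq_1 AE_measure_pmf_iff)

lemma sum_prob_label_class: "(\<Sum>i\<in>labels C. measure_pmf.prob D (label_class C i)) = 1"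
  using sum_improvisations[of "pmf D"] sum_pmf_eq_1[OF finite_improvisations set_improvising]
  by (simp add: measure_measure_pmf_finite finite_label_class)

lemma improvising_conditionals:
  obtains Q where "\<And>i. i \<in> labels C \<Longrightarrow> cond_dist D (label_class C i) (Q i)"
    and "\<And>i. i \<in> labels C \<Longrightarrow> set_pmf (Q i) \<subseteq> label_class C i"
    and "\<And>i y. i \<in> labels C \<Longrightarrow> y \<in> label_class C i \<Longrightarrow>
      real_of_rat (alpha_hat C i) \<le> pmf (Q i) y \<and> pmf (Q i) y \<le> real_of_rat (beta_hat C i)"
proof -
  have "\<forall>i\<in>labels C. \<exists>Q. cond_dist D (label_class C i) Q \<and>
      (\<forall>y\<in>label_class C i. real_of_rat (alpha_hat C i) \<le> pmf Q y \<and> pmf Q y \<le> real_of_rat (beta_hat C i))"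
    using D by (simp add: improvising_def)
  then obtain Q where "\<forall>i\<in>labels C. cond_dist D (label_class C i) (Q i) \<and>
      (\<forall>y\<in>label_class C i. real_of_rat (alpha_hat C i) \<le> pmf (Q i) y \<and> pmf (Q i) y \<le> real_of_rat (beta_hat C i))"
    by metis
  then show ?thesis by (intro that[of Q]) (auto simp: cond_dist_def)
qed

lemma improvising_label_size:
  shows "1 \<le> rho C * of_nat (card (labels C))" "lambda C * of_nat (card (labels C)) \<le> 1"
  using D uniform_bounds_sum_1[OF _ sum_prob_label_class, of "lambda C" "rho C"]
  by (simp_all add: improvising_def)

text \<open>Even for a null class there is a conditional distribution concentrated on it, so the
  word bounds can be summed.\<close>

lemma improvising_class_size:
  assumes "i \<in> labels C"
  shows "1 \<le> beta_hat C i * of_nat (card (label_class C i))"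
    and "alpha_hat C i * of_nat (card (label_class C i)) \<le> 1"
proof -
  obtain Q where Q: "set_pmf Q \<subseteq> label_class C i"
    "\<And>y. y \<in> label_class C i \<Longrightarrow>
      real_of_rat (alpha_hat C i) \<le> pmf Q y \<and> pmf Q y \<le> real_of_rat (beta_hat C i)"
    using improvising_conditionals assms by metis
  from uniform_bounds_sum_1[OF Q(2) sum_pmf_eq_1[OF finite_label_class Q(1)]]
  show "1 \<le> beta_hat C i * of_nat (card (label_class C i))"
    "alpha_hat C i * of_nat (card (label_class C i)) \<le> 1" by auto
qed

lemma greedy_dist_minimal: "expected_cost C (greedy_dist C) \<le> expected_cost C D"
proof -
  let ?P = "\<lambda>i. measure_pmf.prob D (label_class C i)"
  obtain Q where Q: "\<And>i. i \<in> labels C \<Longrightarrow> cond_dist D (label_class C i) (Q i)"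
    "\<And>i. i \<in> labels C \<Longrightarrow> set_pmf (Q i) \<subseteq> label_class C i"
    "\<And>i y. i \<in> labels C \<Longrightarrow> y \<in> label_class C i \<Longrightarrow>
      real_of_rat (alpha_hat C i) \<le> pmf (Q i) y \<and> pmf (Q i) y \<le> real_of_rat (beta_hat C i)"
    using improvising_conditionals by blast
  have "expected_cost C (greedy_dist C) =
    (\<Sum>i\<in>labels C. real_of_rat (label_weight C i) * expected_cost C (greedy_word_dist C i))"
    by (intro expected_cost_greedy_dist improvising_label_size improvising_class_size)
  \<comment> \<open>The label probabilities are exchanged while the conditionals are greedy, as the
    order of the labels requires.\<close>
  also have "\<dots> \<le> (\<Sum>i\<in>labels C. ?P i * expected_cost C (greedy_word_dist C i))"
    using D sum_prob_label_class
    by (intro label_weight_minimal[OF improvising_label_size]) (auto simp: improvising_def)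
  \<comment> \<open>With the label probabilities of \<open>D\<close> fixed and nonnegative, the
    conditionals are compared label by label.\<close>
  also have "\<dots> \<le> (\<Sum>i\<in>labels C. ?P i * expected_cost C (Q i))"
    using Q by (intro sum_mono mult_left_mono greedy_word_dist_minimal improvising_class_size) auto
  also have "\<dots> = expected_cost C D"
    using Q(2) pmf_eq_prob_times_cond_dist[OF Q(1)]
    by (intro expected_cost_mixture[OF set_improvising, symmetric]) auto
  finally show ?thesis .
qed

end

end

theorem theorem1:
  fixes C :: "('a, 'l) lqci"
  assumes "lqci_instance C"
  shows "feasible C \<longleftrightarrow>
    (1 / ereal (real_of_rat (rho C)) \<le> ereal (real (card (labels C))) \<and>
     ereal (real (card (labels C))) \<le> 1 / ereal (real_of_rat (lambda C))) \<and>
    (\<forall>i \<in> labels C.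
       1 / ereal (real_of_rat (beta_hat C i)) \<le> ereal (real (card (label_class C i))) \<and>
       ereal (real (card (label_class C i))) \<le> 1 / ereal (real_of_rat (alpha_hat C i))) \<and>
    expected_cost C (greedy_dist C) \<le> real_of_rat (cost_bound C)"
proof -
  have nonneg: "0 \<le> rho C" "0 \<le> lambda C"
    "\<And>i. i \<in> labels C \<Longrightarrow> 0 \<le> beta_hat C i" "\<And>i. i \<in> labels C \<Longrightarrow> 0 \<le> alpha_hat C i"
    using assms by (force simp: lqci_instance_def)+
  \<comment> \<open>The equivalence is proved with division-free size conditions and translated to
    the extended reals at the end.\<close>
  have "feasible C \<longleftrightarrow>
    (1 \<le> rho C * of_nat (card (labels C)) \<and> lambda C * of_nat (card (labels C)) \<le> 1) \<and>
    (\<forall>i \<in> labels C. 1 \<le> beta_hat C i * of_nat (card (label_class C i)) \<and>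
       alpha_hat C i * of_nat (card (label_class C i)) \<le> 1) \<and>
    expected_cost C (greedy_dist C) \<le> real_of_rat (cost_bound C)" (is "_ \<longleftrightarrow> ?R")
  proof
    assume "feasible C"
    then obtain D where D: "improvising C D" by (auto simp: feasible_def)
    then have "expected_cost C D \<le> real_of_rat (cost_bound C)" by (simp add: improvising_def)
    with greedy_dist_minimal[OF assms D] show ?R
      using improvising_label_size[OF assms D] improvising_class_size[OF assms D] by auto
  next
    assume ?R
    then show "feasible C"
      unfolding feasible_def
      by (intro exI[of _ "greedy_dist C"] improvising_greedy_dist[OF assms]) auto
  qed
  then show ?thesis
    by (simp add: size_bound_ereal nonneg)
qed

end
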